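(* Let $\{a_i\}_{i\ge1}$ be free, identically distributed self-adjoint variables in $(\mathcal{A},\varphi)$ with $\alpha=\varphi(a_1)\ne0$, and let $N_n$, $n\ge1$, be non-negative integer-valued random variables with all moments finite, independent of $\{a_i\}$. Suppose that as $n\to\infty$, $\eta_n\to\infty$, $\sigma_n^2\to\infty$ and $\mathbb{E}[|N_n-\eta_n|^m]=O(\sigma_n^m)$ for all $m\in\mathbb{N}$. Then the joint $*$-convergence of $\{\tilde{\mathcal{S}}_{N_n},\ \delta_n\tilde N_n\cdot 1_{\mathcal{A}}\}$ as $n\to\infty$ is equivalent to the convergence of $\delta_n$ together with the convergence of all the moments of $\delta_n\tilde N_n$. Further, if $\delta_n\to\delta\neq0$, then this $*$-convergence is equivalent to the convergence of all the moments of $\tilde N_n$.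
   Context: $(\mathcal{A},\varphi)$ is a $*$-probability space: a unital $*$-algebra with unit $1_{\mathcal{A}}$ and a positive linear functional $\varphi$ with $\varphi(1_{\mathcal{A}})=1$. "Free" means freely independent; "identically distributed" means $\varphi(a_i^m)=\varphi(a_1^m)$ for all $i,m$. Notation: $\theta^2=\varphi(a_1^2)-\alpha^2$; $\eta_n=\mathbb{E}[N_n]$, $\gamma_n^2=\mathbb{V}\mathrm{ar}(N_n)$, $\sigma_n^2=\eta_n\theta^2+\gamma_n^2\alpha^2$. $\mathcal{S}_k=a_1+\cdots+a_k$, $\mathcal{S}_0=0$, and $\mathcal{S}_{N_n}=a_1+\cdots+a_{N_n}$. Put $\tilde{N}_n=(N_n-\eta_n)/\gamma_n$, $\tilde{\mathcal{S}}_{N_n}=(\mathcal{S}_{N_n}-\eta_n\alpha)/\sigma_n$, $\delta_n=\gamma_n\alpha/\sigma_n$; thus $\delta_n\tilde N_n=\alpha(N_n-\eta_n)/\sigma_n$ (this is taken as its meaning when $\gamma_n=0$). The random sums live in a larger non-commutative probability space with state $\tilde\varphi=\mathbb{E}\varphi$, in which $N_n$ is independent of $\mathcal{A}$ (and central): for a polynomial $P$ and a real function $f$, $\tilde\varphi\big(P(\mathcal{S}_{N_n})f(N_n)\big)=\sum_{i\ge0}\mathbb{P}\{N_n=i\}f(i)\,\varphi(P(\mathcal{S}_i))$. Joint $*$-convergence of self-adjoint variables $\{x_n,y_n\}$ means that $\tilde\varphi(Q(x_n,y_n))$ converges to a finite limit for every non-commutative polynomial $Q$; here, since the two variables commute,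 it means that $\tilde\varphi(\tilde{\mathcal S}_{N_n}^m(\delta_n\tilde N_n)^l)$ converges for all $m,l\ge0$. *)

theory Defs
  imports "HOL-Probability.Probability" "HOL-Library.Poly_Mapping"
begin

locale star_prob_space = vector_space scaleC
  for scaleC :: "complex \<Rightarrow> 'a::ring_1 \<Rightarrow> 'a" +
  fixes star :: "'a \<Rightarrow> 'a" and \<phi> :: "'a \<Rightarrow> complex"
  assumes scaleC_mult_left: "scaleC c x * y = scaleC c (x * y)"
    and scaleC_mult_right: "x * scaleC c y = scaleC c (x * y)"
    and star_star: "star (star x) = x"
    and star_add: "star (x + y) = star x + star y"
    and star_scaleC: "star (scaleC c x) = scaleC (cnj c) (star x)"
    and star_mult: "star (x * y) = star y * star x"
    and \<phi>_add: "\<phi> (x + y) = \<phi> x + \<phi> y"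
    and \<phi>_scaleC: "\<phi> (scaleC c x) = c * \<phi> x"
    and \<phi>_positive: "\<phi> (star x * x) \<in> \<real>\<^sub>\<ge>\<^sub>0"
    and \<phi>_one: "\<phi> 1 = 1"
begin

text \<open>The state is real on self-adjoint elements, so taking real parts of
  the first and second moments of a self-adjoint variable loses nothing.\<close>

lemma star_one: "star 1 = 1"
  by (metis mult.right_neutral star_mult star_star mult.left_neutral)

lemma \<phi>_selfadjoint_real:
  assumes "star x = x"
  shows "\<phi> x = complex_of_real (Re (\<phi> x))"
proof -
  have "star (1 + x) * (1 + x) = 1 + x + x + star x * x"
    using assms by (simp add: star_add star_one algebra_simps)
  then have "\<phi> (star (1 + x) * (1 + x)) = 1 + 2 * \<phi> x + \<phi> (star x * x)"
    by (simp add: \<phi>_add \<phi>_one)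
  moreover have "Im (\<phi> (star (1 + x) * (1 + x))) = 0" "Im (\<phi> (star x * x)) = 0"
    using \<phi>_positive complex_nonneg_Reals_iff by blast+
  ultimately have "Im (\<phi> x) = 0"
    by simp
  then show ?thesis
    by (simp add: complex_eq_iff)
qed

end

definition unital_star_subalgebra ::
  "(complex \<Rightarrow> 'a::ring_1 \<Rightarrow> 'a) \<Rightarrow> ('a \<Rightarrow> 'a) \<Rightarrow> 'a set \<Rightarrow> bool" where
  "unital_star_subalgebra scaleC star B \<longleftrightarrow>
     1 \<in> B \<and> (\<forall>x\<in>B. \<forall>y\<in>B. x + y \<in> B \<and> x * y \<in> B) \<and>
     (\<forall>c. \<forall>x\<in>B. scaleC c x \<in> B) \<and> (\<forall>x\<in>B. star x \<in> B)"

definition generated_star_algebra ::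
  "(complex \<Rightarrow> 'a::ring_1 \<Rightarrow> 'a) \<Rightarrow> ('a \<Rightarrow> 'a) \<Rightarrow> 'a set \<Rightarrow> 'a set" where
  "generated_star_algebra scaleC star X =
     \<Inter>{B. unital_star_subalgebra scaleC star B \<and> X \<subseteq> B}"

text \<open>A word over tagged elements (i, b) encodes a product whose factors are taken from
  the subalgebras B i; neighbouring tags must differ.\<close>

definition free_subalgebras ::
  "('a::ring_1 \<Rightarrow> complex) \<Rightarrow> 'i set \<Rightarrow> ('i \<Rightarrow> 'a set) \<Rightarrow> bool" where
  "free_subalgebras \<phi> I B \<longleftrightarrow>
     (\<forall>ws. ws \<noteq> [] \<longrightarrow> (\<forall>(i, b) \<in> set ws. i \<in> I \<and> b \<in> B i \<and> \<phi> b = 0) \<longrightarrow>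
        successively (\<lambda>p q. fst p \<noteq> fst q) ws \<longrightarrow> \<phi> (prod_list (map snd ws)) = 0)"

definition free_variables ::
  "(complex \<Rightarrow> 'a::ring_1 \<Rightarrow> 'a) \<Rightarrow> ('a \<Rightarrow> 'a) \<Rightarrow> ('a \<Rightarrow> complex) \<Rightarrow> 'i set \<Rightarrow> ('i \<Rightarrow> 'a) \<Rightarrow> bool" where
  "free_variables scaleC star \<phi> I a \<longleftrightarrow>
     free_subalgebras \<phi> I (\<lambda>i. generated_star_algebra scaleC star {a i})"

definition partial_sum :: "(nat \<Rightarrow> 'a::ring_1) \<Rightarrow> nat \<Rightarrow> 'a" where
  "partial_sum a k = (\<Sum>i=1..k. a i)"

text \<open>Variables of the larger space are functions from the sample space to the algebra,
  multiplied pointwise. The original algebra embeds as the constant functions and the scalar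
  random variables as multiples of the unit, so the latter are central and independent of the
  former under the state below: when integrable, the state of
  \<open>P (partial_sum a N) f(N)\<close> is the sum over i of
  \<open>\<P>(N = i) f(i) \<phi> (P (partial_sum a i))\<close>.\<close>

definition random_state ::
  "'w measure \<Rightarrow> ('a \<Rightarrow> complex) \<Rightarrow> ('w \<Rightarrow> 'a) \<Rightarrow> complex" where
  "random_state M \<phi> X = (\<integral>\<omega>. \<phi> (X \<omega>) \<partial>M)"

text \<open>A non-commutative polynomial with letters in \<open>'i\<close> is a finitely supported
  function on words.\<close>

definition nc_poly_eval ::
  "(complex \<Rightarrow> 'a::ring_1 \<Rightarrow> 'a) \<Rightarrow> ('i list \<Rightarrow>\<^sub>0 complex) \<Rightarrow> ('i \<Rightarrow> 'a) \<Rightarrow> 'a" where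
  "nc_poly_eval scaleC Q x =
     (\<Sum>w\<in>Poly_Mapping.keys Q. scaleC (Poly_Mapping.lookup Q w) (prod_list (map x w)))"

text \<open>For families of self-adjoint variables, so no adjoint letters are needed. The Bochner
  integral is 0 on non-integrable functions; the first conjunct ensures that the state is really
  defined on each polynomial from some index on, so that this default value is never used.\<close>

definition joint_star_convergent ::
  "(complex \<Rightarrow> 'a::ring_1 \<Rightarrow> 'a) \<Rightarrow> ('a \<Rightarrow> complex) \<Rightarrow> 'w measure \<Rightarrow> (nat \<Rightarrow> 'i \<Rightarrow> 'w \<Rightarrow> 'a) \<Rightarrow> bool" where
  "joint_star_convergent scaleC \<phi> M X \<longleftrightarrow>
     (\<forall>Q. (\<forall>\<^sub>F n in sequentially. integrable M (\<lambda>\<omega>. \<phi> (nc_poly_eval scaleC Q (\<lambda>i. X n i \<omega>)))) \<and>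
          convergent (\<lambda>n. random_state M \<phi> (\<lambda>\<omega>. nc_poly_eval scaleC Q (\<lambda>i. X n i \<omega>))))"

definition moments_convergent :: "'w measure \<Rightarrow> (nat \<Rightarrow> 'w \<Rightarrow> real) \<Rightarrow> bool" where
  "moments_convergent M Y \<longleftrightarrow> (\<forall>m::nat. convergent (\<lambda>n. \<integral>\<omega>. Y n \<omega> ^ m \<partial>M))"

end

theory Submission
  imports Defs "HOL-Computational_Algebra.Polynomial"
begin

text \<open>Split \<open>S_tilde = T / \<sigma> + \<delta>N\<close>, where \<open>T\<close> is the sum of the \<open>N\<close> centered variables; \<open>\<delta>N\<close> is
  a scalar. Freeness makes the mixed moments of the centered variables invariant under relabelling
  and zero when some variable occurs exactly once, so the \<open>m\<close>-th moment of a sum of \<open>k\<close> of them is a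
  combination of the binomials \<open>k choose r\<close> with \<open>2 r \<le> m\<close>. Hence the joint moments are governed by
  the expectations of \<open>(N choose r) \<delta>N ^ l / \<sigma> ^ (2 r)\<close>. These converge once the moments of \<open>\<delta>N\<close>
  and the ratio \<open>\<eta> / \<sigma>\<^sup>2 = (1 - \<delta>\<^sup>2) / \<theta>2\<close> do; for \<open>\<theta>2 = 0\<close> the moments of \<open>T\<close> vanish by positivity.
  Convergence of \<open>\<delta>\<close> is automatic because \<open>\<delta>\<^sup>2\<close> is the second moment of \<open>\<delta>N\<close> and the sign of \<open>\<delta>\<close>
  is that of \<open>\<alpha>\<close>.\<close>

section \<open>Words over tagged letters\<close>

lemma not_successively_decomp:
  assumes "\<not> successively R w"
  obtains u x y v where "w = u @ x # y # v" "\<not> R x y"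
proof -
  from assms have "\<exists>u x y v. w = u @ x # y # v \<and> \<not> R x y"
  proof (induction R w rule: successively.induct)
    case (3 R x y xs)
    show ?case
    proof (cases "R x y")
      case True
      with 3 obtain u x' y' v where "y # xs = u @ x' # y' # v" "\<not> R x' y'" by auto
      then have "x # y # xs = (x # u) @ x' # y' # v" by simp
      with \<open>\<not> R x' y'\<close> show ?thesis by blast
    next
      case False
      then show ?thesis by (metis append_Nil)
    qed
  qed auto
  with that show thesis by blast
qed

text \<open>Reduction to alternating centered words, the ones on which freeness speaks. Merging two
  neighbours or deleting a letter shortens the word; centering a letter keeps its length, so it
  needs an inner induction along the word.\<close>

lemma tagged_word_induct:
  fixes P :: "('i \<times> 'b::times) list \<Rightarrow> bool"
  assumes merge: "\<And>u i x y v. P (u @ (i, x * y) # v) \<Longrightarrow> P (u @ (i, x) # (i, y) # v)"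
    and center: "\<And>u i x v. P (u @ (i, cent x) # v) \<Longrightarrow> P (u @ v) \<Longrightarrow> P (u @ (i, x) # v)"
    and centered: "\<And>w. successively (\<lambda>p q. fst p \<noteq> fst q) w \<Longrightarrow>
                     \<forall>(i, x) \<in> set w. centered x \<Longrightarrow> P w"
    and centered_cent: "\<And>x. centered (cent x)"
  shows "P w"
proof (induction w rule: length_induct)
  case (1 w)
  show ?case
  proof (cases "successively (\<lambda>p q. fst p \<noteq> fst q) w")
    case False
    then obtain u x y v where w: "w = u @ x # y # v" "fst x = fst y"
      by (rule not_successively_decomp) blast
    then have "P (u @ (fst x, snd x * snd y) # v)"
      using 1 by auto
    then have "P (u @ (fst x, snd x) # (fst x, snd y) # v)"
      by (rule merge)
    with w show ?thesis
      by (metis prod.collapse)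
  next
    case True
    \<comment> \<open>Here \<open>u\<close> is the prefix already centered and \<open>v\<close> the
      part still to be treated. The length condition keeps the outer hypothesis available for words
      with one letter deleted, and centering leaves the tags, hence alternation, untouched.\<close>
    have "P (u @ v)"
      if "length (u @ v) = length w" "successively (\<lambda>p q. fst p \<noteq> fst q) (u @ v)"
         "\<forall>(i, x) \<in> set u. centered x" for u v
      using that
    proof (induction v arbitrary: u)
      case Nil
      then show ?case using centered by simp
    next
      case (Cons z v)
      obtain i x where z: "z = (i, x)" by fastforce
      have "successively (\<noteq>) (map fst (u @ z # v))"
        using Cons.prems(2) by (simp only: successively_map)
      then have "successively (\<noteq>) (map fst ((u @ [(i, cent x)]) @ v))"
        by (simp add: z)
      then have "successively (\<lambda>p q. fst p \<noteq> fst q) ((u @ [(i, cent x)]) @ v)"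
        by (simp only: successively_map)
      then have "P ((u @ [(i, cent x)]) @ v)"
        using Cons.prems centered_cent by (intro Cons.IH) auto
      moreover have "P (u @ v)"
        using 1 Cons.prems(1) by simp
      ultimately show ?case
        using center[of u i x v] by (simp add: z)
    qed
    from this[of "[]" w] True show ?thesis by simp
  qed
qed

lemma sum_power_lists:
  fixes b :: "'i \<Rightarrow> 'a::ring_1"
  assumes "finite A"
  shows "(\<Sum>i\<in>A. b i) ^ m = (\<Sum>w | set w \<subseteq> A \<and> length w = m. prod_list (map b w))"
proof (induction m)
  case 0
  have "{w. set w \<subseteq> A \<and> length w = 0} = {[]}" by auto
  then show ?case by simp
next
  case (Suc m)
  let ?L = "\<lambda>m. {w. set w \<subseteq> A \<and> length w = m}"
  have img: "?L (Suc m) = (\<lambda>(i, w). i # w) ` (A \<times> ?L m)"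
    by (auto simp: length_Suc_conv image_iff)
  have "(\<Sum>i\<in>A. b i) ^ Suc m = (\<Sum>i\<in>A. \<Sum>w\<in>?L m. b i * prod_list (map b w))"
    by (simp add: Suc sum_product)
  also have "\<dots> = (\<Sum>z\<in>A \<times> ?L m. prod_list (map b (case z of (i, w) \<Rightarrow> i # w)))"
    by (simp add: sum.cartesian_product case_prod_unfold)
  also have "\<dots> = (\<Sum>w\<in>?L (Suc m). prod_list (map b w))"
    unfolding img by (subst sum.reindex) (auto simp: inj_on_def)
  finally show ?case .
qed

text \<open>Pigeonhole: if every letter occurred twice or more, the length would be at least twice
  the number of letters.\<close>

lemma exists_single_occurrence:
  assumes "length w < 2 * card (set w)"
  obtains i where "filter (\<lambda>x. x = i) w = [i]"
proof -
  have "\<exists>i\<in>set w. count_list w i < 2"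
  proof (rule ccontr)
    assume "\<not> ?thesis"
    then have "(\<Sum>i\<in>set w. 2) \<le> (\<Sum>i\<in>set w. count_list w i)"
      by (intro sum_mono) auto
    then show False
      using assms sum_count_set[of w "set w"] by simp
  qed
  then obtain i where i: "i \<in> set w" "count_list w i < 2" by blast
  then have "count_list w i = 1"
    by (metis count_notin less_2_cases count_list_0_iff One_nat_def)
  moreover have "(\<lambda>x. x = i) = (=) i" by auto
  ultimately have "length (filter (\<lambda>x. x = i) w) = 1"
    by (simp add: count_list_eq_length_filter)
  then obtain x where x: "filter (\<lambda>x. x = i) w = [x]"
    by (metis One_nat_def length_0_conv length_Suc_conv)
  then have "x \<in> set (filter (\<lambda>x. x = i) w)" by simp
  then have "x = i" by simp
  with x that show thesis by blast
qed

section \<open>Moments of sums of free centered variables\<close>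

context star_prob_space
begin

section \<open>Linearity and positivity of the state\<close>

lemma \<phi>_zero [simp]: "\<phi> 0 = 0"
  using \<phi>_scaleC[of 0 0] by simp

lemma \<phi>_minus: "\<phi> (- x) = - \<phi> x"
  using \<phi>_scaleC[of "-1" x] by simp

lemma \<phi>_diff: "\<phi> (x - y) = \<phi> x - \<phi> y"
  using \<phi>_add[of x "- y"] by (simp add: \<phi>_minus)

lemma \<phi>_sum: "\<phi> (sum f A) = (\<Sum>x\<in>A. \<phi> (f x))"
  by (induction A rule: infinite_finite_induct) (auto simp: \<phi>_add)

lemma star_diff: "star (x - y) = star x - star y"
  using star_add[of x "scaleC (-1) y"] star_scaleC[of "-1" y] by simp

lemma scaleC_one_mult: "scaleC c 1 * x = scaleC c x" "x * scaleC c 1 = scaleC c x"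
  by (simp_all add: scaleC_mult_left scaleC_mult_right)

lemma scaleC_power: "scaleC c x ^ m = scaleC (c ^ m) (x ^ m)"
  by (induction m) (simp_all add: scaleC_mult_left scaleC_mult_right)

text \<open>Expand \<open>\<phi> (star (y + t x) (y + t x)) \<ge> 0\<close>; it is affine in \<open>t\<close> and \<open>cnj t\<close>,
  so the linear part must vanish.\<close>

lemma \<phi>_mult_null:
  assumes x: "star x = x" and null: "\<phi> (x * x) = 0"
  shows "\<phi> (x * y) = 0"
proof -
  have affine: "w = 0" if pos: "\<And>t. c + complex_of_real t * w \<in> \<real>\<^sub>\<ge>\<^sub>0" for c w
  proof -
    have im: "Im w = 0"
      using pos[of 0] pos[of 1] by (simp add: complex_nonneg_Reals_iff)
    moreover have "Re w = 0"
    proof (rule ccontr)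
      assume "Re w \<noteq> 0"
      with pos[of "- (Re c + 1) / Re w"] show False
        by (simp add: complex_nonneg_Reals_iff)
    qed
    ultimately show ?thesis by (simp add: complex_eq_iff)
  qed
  have expand: "\<phi> (star y * y) + t * \<phi> (star y * x) + cnj t * \<phi> (x * y) \<in> \<real>\<^sub>\<ge>\<^sub>0" for t
  proof -
    have "star (y + scaleC t x) * (y + scaleC t x) =
        star y * y + scaleC t (star y * x) + scaleC (cnj t) (x * y) + scaleC (cnj t * t) (x * x)"
      by (simp add: star_add star_scaleC x scaleC_mult_left scaleC_mult_right distrib_left
          distrib_right scale_right_distrib add_ac mult.commute)
    then show ?thesis
      using \<phi>_positive[of "y + scaleC t x"] by (simp add: \<phi>_add \<phi>_scaleC null)
  qed
  \<comment> \<open>Real \<open>t\<close> isolates the sum of the two linear coefficients, imaginary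
    \<open>t\<close> their difference; both vanish, hence so does each coefficient.\<close>
  have "\<phi> (star y * x) + \<phi> (x * y) = 0"
    by (rule affine[of "\<phi> (star y * y)"])
       (use expand[of "complex_of_real t" for t] in \<open>simp add: algebra_simps\<close>)
  moreover have "\<i> * (\<phi> (star y * x) - \<phi> (x * y)) = 0"
    by (rule affine[of "\<phi> (star y * y)"])
       (use expand[of "\<i> * complex_of_real t" for t] in \<open>simp add: algebra_simps\<close>)
  ultimately show ?thesis by simp
qed

section \<open>Evaluation of complex polynomials at an algebra element\<close>

definition poly_apply :: "complex poly \<Rightarrow> 'a \<Rightarrow> 'a" where
  "poly_apply p x = fold_coeffs (\<lambda>c y. scaleC c 1 + x * y) p 0"

lemma poly_apply_0 [simp]: "poly_apply 0 x = 0"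
  by (simp add: poly_apply_def)

lemma poly_apply_pCons [simp]: "poly_apply (pCons c p) x = scaleC c 1 + x * poly_apply p x"
  by (cases "c = 0 \<and> p = 0") (auto simp: poly_apply_def)

lemma poly_apply_add: "poly_apply (p + q) x = poly_apply p x + poly_apply q x"
  by (induction p q rule: poly_induct2)
     (simp_all add: scale_left_distrib distrib_left add_ac)

lemma poly_apply_smult: "poly_apply (smult c p) x = scaleC c (poly_apply p x)"
  by (induction p) (simp_all add: scale_right_distrib scaleC_mult_right)

lemma poly_apply_mult: "poly_apply (p * q) x = poly_apply p x * poly_apply q x"
  by (induction p)
     (simp_all add: mult_pCons_left poly_apply_add poly_apply_smult distrib_right
       scaleC_one_mult mult.assoc)

text \<open>Makes freeness, which is stated for generated star-algebras, applicable to polynomials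
  in one variable.\<close>

lemma poly_apply_generated: "poly_apply p x \<in> generated_star_algebra scaleC star {x}"
proof -
  have "poly_apply p x \<in> B" if B: "unital_star_subalgebra scaleC star B" "x \<in> B" for B
  proof (induction p)
    case 0
    have "scaleC 0 1 \<in> B" using B unfolding unital_star_subalgebra_def by blast
    then show ?case by simp
  next
    case (pCons c p)
    then show ?case using B unfolding unital_star_subalgebra_def by simp
  qed
  then show ?thesis unfolding generated_star_algebra_def by blast
qed

lemma \<phi>_poly_apply_cong:
  assumes "\<And>m. \<phi> (x ^ m) = \<phi> (y ^ m)"
  shows "\<phi> (poly_apply p x) = \<phi> (poly_apply p y)"
proof -
  \<comment> \<open>The extra power absorbs the factor \<open>x\<close> that each coefficient step
    of \<open>poly_apply\<close> produces.\<close>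
  have "\<phi> (x ^ m * poly_apply p x) = \<phi> (y ^ m * poly_apply p y)" for m
  proof (induction p arbitrary: m)
    case (pCons c p)
    then show ?case
      using pCons(2)[of "Suc m"] assms[of m]
      by (simp add: distrib_left \<phi>_add \<phi>_scaleC scaleC_one_mult mult.assoc power_Suc2 del: power_Suc)
  qed simp
  from this[of 0] show ?thesis by simp
qed

end

section \<open>Words in free identically distributed variables\<close>

locale free_iid = star_prob_space +
  fixes a :: "nat \<Rightarrow> 'a"
  assumes free: "free_variables scaleC star \<phi> {1..} a"
    and selfadjoint: "i \<ge> 1 \<Longrightarrow> star (a i) = a i"
    and identically_distributed: "i \<ge> 1 \<Longrightarrow> \<phi> (a i ^ m) = \<phi> (a 1 ^ m)"
begin

definition poly_mean :: "complex poly \<Rightarrow> complex" where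
  "poly_mean p = \<phi> (poly_apply p (a 1))"

text \<open>Letters carry polynomials instead of algebra elements, so that a word can be moved to other
  variables by relabelling its tags.\<close>

definition word_apply :: "(nat \<times> complex poly) list \<Rightarrow> 'a" where
  "word_apply w = prod_list (map (\<lambda>(i, p). poly_apply p (a i)) w)"

lemma \<phi>_poly_apply: "i \<ge> 1 \<Longrightarrow> \<phi> (poly_apply p (a i)) = poly_mean p"
  unfolding poly_mean_def by (rule \<phi>_poly_apply_cong) (rule identically_distributed)

lemma poly_mean_centered: "poly_mean (p - [:poly_mean p:]) = 0"
proof -
  have "\<phi> (poly_apply (p - [:poly_mean p:] + [:poly_mean p:]) (a 1)) = poly_mean p"
    by (simp add: poly_mean_def)
  then show ?thesis
    unfolding poly_apply_add by (simp add: \<phi>_add \<phi>_scaleC \<phi>_one poly_mean_def)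
qed

lemma word_apply_append: "word_apply (u @ v) = word_apply u * word_apply v"
  by (simp add: word_apply_def)

lemma word_apply_Cons: "word_apply ((i, p) # v) = poly_apply p (a i) * word_apply v"
  by (simp add: word_apply_def)

lemma word_apply_merge: "word_apply (u @ (i, p) # (i, q) # v) = word_apply (u @ (i, p * q) # v)"
  by (simp add: word_apply_append word_apply_Cons poly_apply_mult mult.assoc)

lemma \<phi>_word_center:
  "\<phi> (word_apply (u @ (i, p) # v)) =
     \<phi> (word_apply (u @ (i, p - [:c:]) # v)) + c * \<phi> (word_apply (u @ v))"
proof -
  have "poly_apply p (a i) = poly_apply (p - [:c:] + [:c:]) (a i)" by simp
  also have "\<dots> = poly_apply (p - [:c:]) (a i) + scaleC c 1"
    unfolding poly_apply_add by simp
  finally show ?thesis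
    by (simp add: word_apply_append word_apply_Cons distrib_left distrib_right \<phi>_add
        scaleC_one_mult scaleC_mult_right \<phi>_scaleC)
qed

lemma \<phi>_word_alternating:
  assumes "w \<noteq> []" "successively (\<lambda>p q. fst p \<noteq> fst q) w" "fst ` set w \<subseteq> {1..}"
    and centered: "\<forall>(i, p) \<in> set w. poly_mean p = 0"
  shows "\<phi> (word_apply w) = 0"
proof -
  let ?w = "map (\<lambda>(i, p). (i, poly_apply p (a i))) w"
  have "successively (\<lambda>p q. fst p \<noteq> fst q) ?w"
    using assms(2) by (simp add: successively_map case_prod_unfold)
  moreover have "\<forall>(i, b) \<in> set ?w. i \<in> {1..} \<and> b \<in> generated_star_algebra scaleC star {a i} \<and> \<phi> b = 0"
    using assms(3) centered by (fastforce simp: poly_apply_generated \<phi>_poly_apply)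
  ultimately have "\<phi> (prod_list (map snd ?w)) = 0"
    using free assms(1) unfolding free_variables_def free_subalgebras_def by blast
  moreover have "map snd ?w = map (\<lambda>(i, p). poly_apply p (a i)) w"
    by (simp add: case_prod_unfold)
  ultimately show ?thesis by (simp only: word_apply_def)
qed

text \<open>Merging and centering commute with relabelling, because the mean of a polynomial is the
  same for every variable. For alternating centered words both sides are zero: injectivity of
  \<open>\<rho>\<close> keeps neighbouring tags distinct.\<close>

lemma \<phi>_word_exchangeable:
  assumes "inj_on \<rho> A" "A \<subseteq> {1..}" "\<rho> ` A \<subseteq> {1..}" "fst ` set w \<subseteq> A"
  shows "\<phi> (word_apply (map (apfst \<rho>) w)) = \<phi> (word_apply w)"
proof -
  let ?cent = "\<lambda>p. p - [:poly_mean p:]"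
  have "fst ` set w \<subseteq> A \<longrightarrow> \<phi> (word_apply (map (apfst \<rho>) w)) = \<phi> (word_apply w)"
  proof (induction w rule: tagged_word_induct[where cent = ?cent and centered = "\<lambda>p. poly_mean p = 0"])
    case (1 u i x y v)
    then show ?case by (simp add: word_apply_merge)
  next
    case (2 u i x v)
    then show ?case
      by (simp add: \<phi>_word_center[where c = "poly_mean x" and p = x])
  next
    case (3 w)
    show ?case
    proof
      assume A: "fst ` set w \<subseteq> A"
      have "successively (\<lambda>p q. \<rho> (fst p) \<noteq> \<rho> (fst q)) w"
        using 3(1) by (rule successively_mono)
          (use A assms(1) in \<open>auto dest!: inj_onD simp: image_subset_iff\<close>)
      then have "successively (\<lambda>p q. fst p \<noteq> fst q) (map (apfst \<rho>) w)"
        by (simp add: successively_map)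
      moreover have "fst ` set (map (apfst \<rho>) w) \<subseteq> {1..}"
        using A assms(3) by fastforce
      moreover have "\<forall>(i, p) \<in> set (map (apfst \<rho>) w). poly_mean p = 0"
        using 3(2) by auto
      ultimately show "\<phi> (word_apply (map (apfst \<rho>) w)) = \<phi> (word_apply w)"
        using 3 A assms(2) \<phi>_word_alternating[of w] \<phi>_word_alternating[of "map (apfst \<rho>) w"]
        by (cases "w = []") auto
    qed
  qed (rule poly_mean_centered)
  with assms(4) show ?thesis by simp
qed

text \<open>The reduction preserves the assumption: the only letter with tag \<open>i\<close> has no
  partner to merge with, and centering other letters does not affect it. Nonempty alternating
  centered words vanish by freeness, and an empty word has no letter with tag
  \<open>i\<close>.\<close>

lemma \<phi>_word_singleton:
  assumes "fst ` set w \<subseteq> {1..}" "filter (\<lambda>z. fst z = i) w = [(i, p)]" "poly_mean p = 0"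
  shows "\<phi> (word_apply w) = 0"
proof -
  let ?cent = "\<lambda>p. p - [:poly_mean p:]"
  have "fst ` set w \<subseteq> {1..} \<longrightarrow> (\<forall>p. filter (\<lambda>z. fst z = i) w = [(i, p)] \<longrightarrow> poly_mean p = 0 \<longrightarrow>
          \<phi> (word_apply w) = 0)"
  proof (induction w rule: tagged_word_induct[where cent = ?cent and centered = "\<lambda>p. poly_mean p = 0"])
    case (1 u j x y v)
    then show ?case by (auto simp: word_apply_merge append_eq_Cons_conv split: if_splits)
  next
    case (2 u j x v)
    show ?case
    proof (intro impI allI)
      fix p
      assume w: "fst ` set (u @ (j, x) # v) \<subseteq> {1..}" "poly_mean p = 0"
        and single: "filter (\<lambda>z. fst z = i) (u @ (j, x) # v) = [(i, p)]"
      have split: "\<phi> (word_apply (u @ (j, x) # v)) = \<phi> (word_apply (u @ (j, ?cent x) # v)) +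
                     poly_mean x * \<phi> (word_apply (u @ v))"
        by (rule \<phi>_word_center)
      show "\<phi> (word_apply (u @ (j, x) # v)) = 0"
      \<comment> \<open>If the letter being centered is the single one, its mean is zero, so the
        term with that letter deleted has coefficient zero. Otherwise both terms still contain the
        single letter and vanish by induction.\<close>
      proof (cases "j = i")
        case True
        with single have "filter (\<lambda>z. fst z = i) u = []" "filter (\<lambda>z. fst z = i) v = []" "x = p"
          by (simp_all add: append_eq_Cons_conv)
        then have "filter (\<lambda>z. fst z = i) (u @ (j, ?cent x) # v) = [(i, ?cent x)]"
          using True by simp
        then have "\<phi> (word_apply (u @ (j, ?cent x) # v)) = 0"
          using 2(1) w(1) poly_mean_centered[of x] by simp
        then show ?thesis using split w(2) \<open>x = p\<close> by simp
      next
        case False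
        with single have "filter (\<lambda>z. fst z = i) (u @ (j, ?cent x) # v) = [(i, p)]"
            "filter (\<lambda>z. fst z = i) (u @ v) = [(i, p)]"
          by simp_all
        then have "\<phi> (word_apply (u @ (j, ?cent x) # v)) = 0" "\<phi> (word_apply (u @ v)) = 0"
          using 2 w by auto
        then show ?thesis using split by simp
      qed
    qed
  next
    case (3 w)
    then show ?case
      using \<phi>_word_alternating[of w] by (cases "w = []") auto
  qed (rule poly_mean_centered)
  with assms show ?thesis by blast
qed

section \<open>Centered variables and the moments of their sums\<close>

definition centered :: "nat \<Rightarrow> 'a" where
  "centered i = a i - scaleC (\<phi> (a 1)) 1"

lemma star_centered: "i \<ge> 1 \<Longrightarrow> star (centered i) = centered i"
  using \<phi>_selfadjoint_real[of "a 1"] selfadjoint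
  by (metis centered_def complex_cnj_complex_of_real order_refl star_diff star_one star_scaleC)

lemma centered_variance:
  assumes "i \<ge> 1"
  shows "\<phi> (centered i * centered i) = \<phi> (a 1 ^ 2) - \<phi> (a 1) ^ 2"
proof -
  define c where "c = \<phi> (a 1)"
  have "centered i * centered i = a i ^ 2 - scaleC (c + c) (a i) + scaleC (c ^ 2) 1"
    unfolding centered_def c_def[symmetric]
    unfolding scale_left_distrib
    by (simp add: left_diff_distrib right_diff_distrib scaleC_one_mult power2_eq_square
        scale_right_diff_distrib)
  moreover have "\<phi> (a i) = c"
    using identically_distributed[OF assms, of 1] by (simp add: c_def)
  ultimately show ?thesis
    using identically_distributed[OF assms, of 2]
    by (simp add: \<phi>_add \<phi>_diff \<phi>_scaleC \<phi>_one power2_eq_square distrib_right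
        flip: c_def del: One_nat_def)
qed

text \<open>With zero variance, positivity makes each centered variable null under the state against
  every right factor, so one factor of the power suffices.\<close>

lemma \<phi>_power_centered_sum_null:
  assumes "\<phi> (a 1 ^ 2) = \<phi> (a 1) ^ 2" "j \<ge> 1"
  shows "\<phi> ((\<Sum>i=1..k. centered i) ^ j) = 0"
proof -
  have "\<phi> (centered i * y) = 0" if "i \<ge> 1" for i y
    by (rule \<phi>_mult_null)
       (use assms(1) centered_variance star_centered that in \<open>simp_all del: One_nat_def\<close>)
  then have "\<phi> ((\<Sum>i=1..k. centered i) * y) = 0" for y
    by (simp add: sum_distrib_right \<phi>_sum)
  with \<open>j \<ge> 1\<close> show ?thesis by (cases j) auto
qed

definition word_moment :: "nat list \<Rightarrow> complex" where
  "word_moment w = \<phi> (prod_list (map centered w))"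

text \<open>Each centered variable is the polynomial \<open>X - \<phi> (a 1)\<close> at
  \<open>a i\<close>, which brings the results on polynomial words to bear.\<close>

lemma word_moment_eq:
  "word_moment w = \<phi> (word_apply (map (\<lambda>i. (i, [:- \<phi> (a 1), 1:])) w))"
  by (simp add: word_moment_def word_apply_def o_def centered_def[abs_def])

lemma word_moment_exchangeable:
  assumes "inj_on \<rho> A" "A \<subseteq> {1..}" "\<rho> ` A \<subseteq> {1..}" "set w \<subseteq> A"
  shows "word_moment (map \<rho> w) = word_moment w"
  unfolding word_moment_eq
  using \<phi>_word_exchangeable[OF assms(1-3), of "map (\<lambda>i. (i, [:- \<phi> (a 1), 1:])) w"] assms(4)
  by (simp add: image_image o_def)

lemma word_moment_eq_0:
  assumes "set w \<subseteq> {1..}" "length w < 2 * card (set w)"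
  shows "word_moment w = 0"
proof -
  obtain i where "filter (\<lambda>x. x = i) w = [i]"
    using exists_single_occurrence[OF assms(2)] by blast
  moreover have "poly_mean [:- \<phi> (a 1), 1:] = 0"
    by (simp add: poly_mean_def \<phi>_diff \<phi>_scaleC \<phi>_one)
  ultimately show ?thesis
    unfolding word_moment_eq
    by (intro \<phi>_word_singleton[where i = i]) (use assms(1) in \<open>auto simp: filter_map o_def\<close>)
qed

text \<open>For \<open>R\<close> with \<open>r\<close> elements this is the coefficient of
  \<open>k choose r\<close> in the moment formula below; the words are the surjections from
  \<open>m\<close> positions onto \<open>R\<close>.\<close>

definition surjective_word_moments :: "nat \<Rightarrow> nat set \<Rightarrow> complex" where
  "surjective_word_moments m R = (\<Sum>w | set w = R \<and> length w = m. word_moment w)"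

lemma surjective_word_moments_card:
  assumes "R \<subseteq> {1..}" "finite R"
  shows "surjective_word_moments m R = surjective_word_moments m {1..card R}"
proof -
  obtain \<rho> where \<rho>: "bij_betw \<rho> {1..card R} R"
    using assms(2) by (metis card_atLeastAtMost diff_Suc_1 finite_atLeastAtMost finite_same_card_bij)
  have inj: "inj_on \<rho> {1..card R}" and im: "\<rho> ` {1..card R} = R"
    using \<rho> by (auto simp: bij_betw_def)
  let ?L = "\<lambda>R. {w. set w = R \<and> length w = m}"
  have "inj_on (map \<rho>) (?L {1..card R})"
    by (rule inj_onI) (use inj in \<open>auto intro!: map_inj_on[where f = \<rho>]\<close>)
  moreover have "map \<rho> ` ?L {1..card R} = ?L R"
  proof (intro equalityI subsetI)
    fix w assume w: "w \<in> ?L R"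
    let ?g = "the_inv_into {1..card R} \<rho>"
    have "map \<rho> (map ?g w) = w"
      unfolding map_map by (rule map_idI) (use w im f_the_inv_into_f[OF inj] in auto)
    moreover have "set (map ?g w) = {1..card R}"
      using w im the_inv_into_onto[OF inj] by simp
    ultimately show "w \<in> map \<rho> ` ?L {1..card R}"
      using w by (intro image_eqI[of _ _ "map ?g w"]) auto
  qed (use im in auto)
  ultimately have "surjective_word_moments m R = (\<Sum>w\<in>?L {1..card R}. word_moment (map \<rho> w))"
    unfolding surjective_word_moments_def by (intro sum.reindex_cong[of "map \<rho>"]) auto
  also have "\<dots> = surjective_word_moments m {1..card R}"
    unfolding surjective_word_moments_def
    by (intro sum.cong refl word_moment_exchangeable[OF inj]) (use im assms in auto)
  finally show ?thesis .
qed

text \<open>Expand the power into words and group them by their set of letters. By exchangeability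
  only the size \<open>r\<close> of that set matters, and there are \<open>k choose r\<close> such
  sets.\<close>

theorem \<phi>_power_centered_sum:
  "\<phi> ((\<Sum>i=1..k. centered i) ^ m) =
     (\<Sum>r\<le>m div 2. of_nat (k choose r) * surjective_word_moments m {1..r})"
proof -
  let ?L = "{w. set w \<subseteq> {1..k} \<and> length w = m}"
  let ?g = "\<lambda>r. surjective_word_moments m {1..r}"
  have fin: "finite ?L" by (rule finite_lists_length_eq) simp
  have "\<phi> ((\<Sum>i=1..k. centered i) ^ m) = (\<Sum>w\<in>?L. word_moment w)"
    by (simp add: sum_power_lists \<phi>_sum word_moment_def)
  also have "\<dots> = (\<Sum>R\<in>Pow {1..k}. \<Sum>w | w \<in> ?L \<and> set w = R. word_moment w)"
    by (rule sum.group[symmetric]) (use fin in auto)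
  also have "\<dots> = (\<Sum>R\<in>Pow {1..k}. ?g (card R))"
  proof (intro sum.cong refl)
    fix R assume R: "R \<in> Pow {1..k}"
    then have "{w. w \<in> ?L \<and> set w = R} = {w. set w = R \<and> length w = m}" by auto
    moreover have "R \<subseteq> {1..}" using R by auto
    ultimately show "(\<Sum>w | w \<in> ?L \<and> set w = R. word_moment w) = ?g (card R)"
      using R surjective_word_moments_card[of R m] finite_subset[of R "{1..k}"]
      by (simp add: surjective_word_moments_def)
  qed
  also have "\<dots> = (\<Sum>r\<le>k. \<Sum>R | R \<in> Pow {1..k} \<and> card R = r. ?g (card R))"
    by (rule sum.group[symmetric]) (auto dest: card_mono[rotated])
  also have "\<dots> = (\<Sum>r\<le>k. of_nat (k choose r) * ?g r)"
    by (simp add: n_subsets)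
  \<comment> \<open>A word of length \<open>m\<close> with more than \<open>m / 2\<close> distinct
    letters has a letter occurring once, so its moment vanishes.\<close>
  also have "\<dots> = (\<Sum>r\<in>{..k} \<inter> {..m div 2}. of_nat (k choose r) * ?g r)"
  proof (rule sum.mono_neutral_right)
    show "\<forall>r\<in>{..k} - {..k} \<inter> {..m div 2}. of_nat (k choose r) * ?g r = 0"
    proof
      fix r assume "r \<in> {..k} - {..k} \<inter> {..m div 2}"
      then have "m < 2 * r" by auto
      then have "?g r = 0"
        unfolding surjective_word_moments_def
        by (intro sum.neutral ballI word_moment_eq_0) auto
      then show "of_nat (k choose r) * ?g r = 0" by simp
    qed
  qed auto
  \<comment> \<open>Binomials with \<open>r > k\<close> are zero, so the summation range can be made
    independent of \<open>k\<close>.\<close>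
  also have "\<dots> = (\<Sum>r\<le>m div 2. of_nat (k choose r) * ?g r)"
    by (rule sum.mono_neutral_left) auto
  finally show ?thesis .
qed

end

section \<open>Random numbers of summands\<close>

lemma Suc_times_binomial_real:
  "real (Suc r) * real (n choose Suc r) = (real n - real r) * real (n choose r)"
  using gbinomial_mult_1[of "real n" r] by (simp add: binomial_gbinomial algebra_simps)

lemma convergent_power:
  fixes f :: "nat \<Rightarrow> real"
  assumes "convergent f"
  shows "convergent (\<lambda>n. f n ^ m)"
  using assms unfolding convergent_def by (blast intro: tendsto_power)

lemma convergent_eventually_eq:
  assumes "convergent f" "\<forall>\<^sub>F n in sequentially. f n = g n"
  shows "convergent g"
  using assms convergent_cong by blast

text \<open>The polynomial factor is there for the induction: it absorbs the factor
  \<open>X - r\<close> from lowering \<open>Suc r\<close> to \<open>r\<close>.\<close>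

lemma integrable_binomial_poly:
  fixes X :: "'w \<Rightarrow> nat"
  assumes "\<And>m. integrable M (\<lambda>\<omega>. real (X \<omega>) ^ m)"
  shows "integrable M (\<lambda>\<omega>. real (X \<omega> choose r) * poly p (real (X \<omega>)))"
proof (induction r arbitrary: p)
  case 0
  show ?case by (simp add: poly_altdef assms)
next
  case (Suc r)
  have "real (x choose Suc r) * poly p (real x) =
      real (x choose r) * poly (smult (1 / real (Suc r)) ([:- real r, 1:] * p)) (real x)" for x
  proof -
    have *: "real (x choose Suc r) = (real x - real r) * real (x choose r) / real (Suc r)"
      using Suc_times_binomial_real[of r x] by (simp add: eq_divide_eq mult.commute)
    show ?thesis
      unfolding * by (simp add: field_simps del: binomial_Suc_Suc of_nat_Suc)
  qed
  then show ?case using Suc by presburger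
qed

section \<open>Asymptotics of binomials of the random index\<close>

locale random_index =
  fixes M :: "'w measure" and N :: "nat \<Rightarrow> 'w \<Rightarrow> nat"
    and \<alpha> :: real and \<eta> \<sigma> :: "nat \<Rightarrow> real"
  assumes mean_nonzero: "\<alpha> \<noteq> 0"
    and moments_finite: "n \<ge> 1 \<Longrightarrow> integrable M (\<lambda>\<omega>. real (N n \<omega>) ^ m)"
    and scale_at_top: "filterlim \<sigma> at_top sequentially"
begin

text \<open>This is \<open>\<delta>N\<close> of the final theorem. Dividing by \<sigma> instead of
  the standard deviation of \<open>N n\<close> keeps it meaningful when that deviation is
  zero.\<close>

definition fluctuation :: "nat \<Rightarrow> 'w \<Rightarrow> real" where
  "fluctuation n \<omega> = \<alpha> * (real (N n \<omega>) - \<eta> n) / \<sigma> n"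

lemma scale_pos: "\<forall>\<^sub>F n in sequentially. \<sigma> n > 0"
  using scale_at_top by (simp add: filterlim_at_top_dense)

lemma scale_inverse_tendsto_0: "(\<lambda>n. 1 / \<sigma> n) \<longlonglongrightarrow> 0"
  using tendsto_inverse_0_at_top[OF scale_at_top] by (simp add: inverse_eq_divide)

lemma integrable_binomial_fluctuation:
  assumes "n \<ge> 1"
  shows "integrable M (\<lambda>\<omega>. real (N n \<omega> choose r) * fluctuation n \<omega> ^ l)"
proof -
  have "fluctuation n \<omega> ^ l = poly ([:- \<alpha> * \<eta> n / \<sigma> n, \<alpha> / \<sigma> n:] ^ l) (real (N n \<omega>))" for \<omega>
    by (simp add: fluctuation_def diff_divide_distrib right_diff_distrib mult.commute)
  then show ?thesis
    using integrable_binomial_poly[OF moments_finite[OF assms]] by presburger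
qed

text \<open>Since \<open>(r + 1) (N choose (r + 1)) = (N - r) (N choose r)\<close> and
  \<open>N = \<eta> + \<sigma> fluctuation / \<alpha>\<close>, each step in \<open>r\<close> costs a factor \<open>\<eta> / \<sigma>\<^sup>2 + O(1 / \<sigma>)\<close>.\<close>

lemma binomial_fluctuation_convergent:
  assumes ratio: "convergent (\<lambda>n. \<eta> n / \<sigma> n ^ 2)"
    and moments: "moments_convergent M fluctuation"
  shows "convergent (\<lambda>n. (\<integral>\<omega>. real (N n \<omega> choose r) * fluctuation n \<omega> ^ l \<partial>M) / \<sigma> n ^ (2 * r))"
proof (induction r arbitrary: l)
  case 0
  show ?case using moments by (simp add: moments_convergent_def)
next
  case (Suc r)
  define A where
    "A l n = (\<integral>\<omega>. real (N n \<omega> choose r) * fluctuation n \<omega> ^ l \<partial>M) / \<sigma> n ^ (2 * r)" for l n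
  \<comment> \<open>The recursion in \<open>r\<close> after division by
    \<open>\<sigma> n ^ (2 * Suc r)\<close>: the term with \<open>\<eta> n - r\<close> receives the
    full \<open>1 / \<sigma> n ^ 2\<close>, while the fluctuation term keeps a factor
    \<open>1 / \<sigma> n\<close> and raises \<open>l\<close> by one.\<close>
  define B where
    "B n = 1 / real (Suc r) * ((\<eta> n / \<sigma> n ^ 2 - real r * (1 / \<sigma> n) ^ 2) * A l n
              + 1 / \<alpha> * (1 / \<sigma> n) * A (Suc l) n)" for n
  have s: "convergent (\<lambda>n. 1 / \<sigma> n)"
    using scale_inverse_tendsto_0 by (rule convergentI)
  have "convergent (A l)" for l
    using Suc[of l] by (simp add: A_def[abs_def])
  then have "convergent B"
    unfolding B_def[abs_def]
    by (intro convergent_mult convergent_add convergent_diff convergent_const convergent_power s ratio)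
  moreover have "\<forall>\<^sub>F n in sequentially. B n =
     (\<integral>\<omega>. real (N n \<omega> choose Suc r) * fluctuation n \<omega> ^ l \<partial>M) / \<sigma> n ^ (2 * Suc r)"
    using scale_pos eventually_ge_at_top[of 1]
  proof eventually_elim
    case (elim n)
    let ?C = "\<lambda>l \<omega>. real (N n \<omega> choose r) * fluctuation n \<omega> ^ l"
    have "real (N n \<omega> choose Suc r) * fluctuation n \<omega> ^ l =
        (\<eta> n - real r) / real (Suc r) * ?C l \<omega> + \<sigma> n / (\<alpha> * real (Suc r)) * ?C (Suc l) \<omega>" for \<omega>
    proof -
      have "real (N n \<omega>) = \<eta> n + \<sigma> n * fluctuation n \<omega> / \<alpha>"
        using elim(1) mean_nonzero by (simp add: fluctuation_def)
      then have *: "real (N n \<omega> choose Suc r) =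
          (\<eta> n + \<sigma> n * fluctuation n \<omega> / \<alpha> - real r) * real (N n \<omega> choose r) / real (Suc r)"
        using Suc_times_binomial_real[of r "N n \<omega>"]
        by (simp add: field_simps del: binomial_Suc_Suc of_nat_Suc)
      show ?thesis
        unfolding * using mean_nonzero
        by (simp add: field_simps del: binomial_Suc_Suc of_nat_Suc)
    qed
    then have "(\<integral>\<omega>. real (N n \<omega> choose Suc r) * fluctuation n \<omega> ^ l \<partial>M) =
        (\<eta> n - real r) / real (Suc r) * (\<integral>\<omega>. ?C l \<omega> \<partial>M)
          + \<sigma> n / (\<alpha> * real (Suc r)) * (\<integral>\<omega>. ?C (Suc l) \<omega> \<partial>M)"
      using integrable_binomial_fluctuation[OF elim(2), of r]
      by (simp only: Bochner_Integration.integral_add integrable_mult_right integral_mult_right_zero)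
    then show ?case
      unfolding B_def A_def using elim(1) mean_nonzero
      by (simp only:) (simp add: field_simps power2_eq_square power_add del: binomial_Suc_Suc of_nat_Suc)
  qed
  ultimately show ?case
    by (rule convergent_eventually_eq)
qed

end

section \<open>Joint moments of the random sum and the scalar fluctuation\<close>

locale free_random_sum = free_iid scaleC star \<phi> a + random_index M N \<alpha> \<eta> \<sigma>
  for scaleC :: "complex \<Rightarrow> 'a::ring_1 \<Rightarrow> 'a" and star \<phi> a
    and M :: "'w measure" and N \<alpha> \<eta> \<sigma> +
  assumes mean: "\<phi> (a 1) = complex_of_real \<alpha>"
begin

definition centered_sum :: "nat \<Rightarrow> 'w \<Rightarrow> 'a" where
  "centered_sum n \<omega> = scaleC (complex_of_real (1 / \<sigma> n)) (\<Sum>i=1..N n \<omega>. centered i)"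

text \<open>The two variables form one family with letter type \<open>bool\<close>, the shape that
  \<open>joint_star_convergent\<close> takes.\<close>

definition normalized_pair :: "nat \<Rightarrow> bool \<Rightarrow> 'w \<Rightarrow> 'a" where
  "normalized_pair n b = (\<lambda>\<omega>. if b
     then scaleC (complex_of_real (1 / \<sigma> n))
            (partial_sum a (N n \<omega>) - scaleC (complex_of_real (\<eta> n * \<alpha>)) 1)
     else scaleC (complex_of_real (fluctuation n \<omega>)) 1)"

lemma normalized_pair_True:
  "normalized_pair n True \<omega> = centered_sum n \<omega> + scaleC (complex_of_real (fluctuation n \<omega>)) 1"
proof -
  have "partial_sum a k = (\<Sum>i=1..k. centered i) + scaleC (of_nat k * \<alpha>) 1" for k
    by (induction k)
       (simp_all add: partial_sum_def centered_def mean algebra_simps scale_left_distrib del: One_nat_def)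
  then show ?thesis
    by (simp add: normalized_pair_def centered_sum_def fluctuation_def scale_right_distrib
        scale_right_diff_distrib diff_divide_distrib right_diff_distrib scale_left_diff_distrib mult.commute)
qed

lemma \<phi>_centered_sum_power:
  "\<phi> (centered_sum n \<omega> ^ j) = (\<Sum>r\<le>j div 2. surjective_word_moments j {1..r} *
      complex_of_real ((1 / \<sigma> n) ^ j * real (N n \<omega> choose r)))"
  by (simp add: centered_sum_def scaleC_power \<phi>_scaleC \<phi>_power_centered_sum sum_distrib_left mult_ac
      del: One_nat_def)

lemma centered_sum_power_null:
  assumes "\<phi> (a 1 ^ 2) = \<phi> (a 1) ^ 2" "j \<ge> 1"
  shows "\<phi> (centered_sum n \<omega> ^ j) = 0"
  using \<phi>_power_centered_sum_null[OF assms]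
  by (simp add: centered_sum_def scaleC_power \<phi>_scaleC del: One_nat_def)

lemma centered_sum_integrable:
  assumes "n \<ge> 1"
  shows "integrable M (\<lambda>\<omega>. \<phi> (centered_sum n \<omega> ^ j) * complex_of_real (fluctuation n \<omega> ^ l))"
proof -
  have "integrable M (\<lambda>\<omega>. \<Sum>r\<le>j div 2. surjective_word_moments j {1..r} *
      complex_of_real ((1 / \<sigma> n) ^ j * (real (N n \<omega> choose r) * fluctuation n \<omega> ^ l)))"
    using assms
    by (intro Bochner_Integration.integrable_sum integrable_mult_right integrable_of_real
        integrable_binomial_fluctuation)
  then show ?thesis
    by (simp add: \<phi>_centered_sum_power sum_distrib_left mult_ac del: One_nat_def)
qed

lemma centered_sum_convergent:
  assumes moments: "moments_convergent M fluctuation"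
    and degenerate: "convergent (\<lambda>n. \<eta> n / \<sigma> n ^ 2) \<or>
      (\<forall>n \<omega>. \<forall>j\<ge>1. \<phi> (centered_sum n \<omega> ^ j) = 0)"
  shows "convergent (\<lambda>n. \<integral>\<omega>. \<phi> (centered_sum n \<omega> ^ j) * complex_of_real (fluctuation n \<omega> ^ l) \<partial>M)"
  using degenerate
proof
  assume ratio: "convergent (\<lambda>n. \<eta> n / \<sigma> n ^ 2)"
  define A where
    "A r n = (\<integral>\<omega>. real (N n \<omega> choose r) * fluctuation n \<omega> ^ l \<partial>M) / \<sigma> n ^ (2 * r)" for r n
  \<comment> \<open>Normalizing the binomial moment by \<open>\<sigma> n ^ (2 * r)\<close> leaves
    the power \<open>j - 2 * r\<close> of \<open>1 / \<sigma> n\<close>; the bound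
    \<open>r \<le> j div 2\<close> prevents truncation of this difference.\<close>
  define B where
    "B n = (\<Sum>r\<le>j div 2. surjective_word_moments j {1..r} *
       complex_of_real ((1 / \<sigma> n) ^ (j - 2 * r) * A r n))" for n
  have "convergent (\<lambda>n. 1 / \<sigma> n)"
    using scale_inverse_tendsto_0 by (rule convergentI)
  moreover have "convergent (A r)" for r
    using binomial_fluctuation_convergent[OF ratio moments] by (simp add: A_def[abs_def])
  ultimately have "convergent B"
    unfolding B_def[abs_def]
    by (intro convergent_sum convergent_mult convergent_of_real convergent_const convergent_power)
  moreover have "\<forall>\<^sub>F n in sequentially. B n =
      (\<integral>\<omega>. \<phi> (centered_sum n \<omega> ^ j) * complex_of_real (fluctuation n \<omega> ^ l) \<partial>M)"
    using scale_pos eventually_ge_at_top[of 1]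
  proof eventually_elim
    case (elim n)
    have "(\<integral>\<omega>. \<phi> (centered_sum n \<omega> ^ j) * complex_of_real (fluctuation n \<omega> ^ l) \<partial>M) =
       (\<integral>\<omega>. (\<Sum>r\<le>j div 2. surjective_word_moments j {1..r} *
      complex_of_real ((1 / \<sigma> n) ^ j * (real (N n \<omega> choose r) * fluctuation n \<omega> ^ l))) \<partial>M)"
      by (simp add: \<phi>_centered_sum_power sum_distrib_left mult_ac del: One_nat_def)
    also have "\<dots> = (\<Sum>r\<le>j div 2. \<integral>\<omega>. surjective_word_moments j {1..r} *
      complex_of_real ((1 / \<sigma> n) ^ j * (real (N n \<omega> choose r) * fluctuation n \<omega> ^ l)) \<partial>M)"
      using elim(2)
      by (intro Bochner_Integration.integral_sum integrable_mult_right integrable_of_real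
        integrable_binomial_fluctuation)
    also have "\<dots> = (\<Sum>r\<le>j div 2. surjective_word_moments j {1..r} *
      complex_of_real ((1 / \<sigma> n) ^ j * (\<integral>\<omega>. real (N n \<omega> choose r) * fluctuation n \<omega> ^ l \<partial>M)))"
      by (simp only: integral_mult_right_zero integral_complex_of_real)
    also have "\<dots> = B n"
      unfolding B_def
    proof (intro sum.cong refl)
      fix r assume "r \<in> {..j div 2}"
      then have "(1 / \<sigma> n) ^ j = (1 / \<sigma> n) ^ (j - 2 * r) / \<sigma> n ^ (2 * r)"
        by (simp add: power_divide flip: power_add)
      then show "surjective_word_moments j {1..r} *
          complex_of_real ((1 / \<sigma> n) ^ j * (\<integral>\<omega>. real (N n \<omega> choose r) * fluctuation n \<omega> ^ l \<partial>M)) =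
        surjective_word_moments j {1..r} * complex_of_real ((1 / \<sigma> n) ^ (j - 2 * r) * A r n)"
        by (simp add: A_def)
    qed
    finally show ?case by simp
  qed
  ultimately show ?thesis
    by (rule convergent_eventually_eq)
next
  assume null: "\<forall>n \<omega>. \<forall>j\<ge>1. \<phi> (centered_sum n \<omega> ^ j) = 0"
  show ?thesis
  proof (cases "j = 0")
    case True
    then show ?thesis
      using moments by (simp add: \<phi>_one moments_convergent_def convergent_of_real del: of_real_power)
  next
    case False
    then show ?thesis using null by (simp add: convergent_const)
  qed
qed

text \<open>The word is consumed from the left, with powers of the centered sum collected in
  \<open>j\<close> and scalars in \<open>l\<close>. A letter \<open>False\<close> raises
  \<open>l\<close>; a letter \<open>True\<close> splits into a term raising \<open>j\<close> and one
  raising \<open>l\<close>. The empty word is the case already settled.\<close>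

lemma normalized_word_convergent:
  assumes moments: "moments_convergent M fluctuation"
    and degenerate: "convergent (\<lambda>n. \<eta> n / \<sigma> n ^ 2) \<or>
      (\<forall>n \<omega>. \<forall>j\<ge>1. \<phi> (centered_sum n \<omega> ^ j) = 0)"
  shows "(\<forall>n\<ge>1. integrable M (\<lambda>\<omega>. \<phi> (centered_sum n \<omega> ^ j *
             prod_list (map (\<lambda>b. normalized_pair n b \<omega>) w)) * complex_of_real (fluctuation n \<omega> ^ l))) \<and>
         convergent (\<lambda>n. \<integral>\<omega>. \<phi> (centered_sum n \<omega> ^ j *
             prod_list (map (\<lambda>b. normalized_pair n b \<omega>) w)) * complex_of_real (fluctuation n \<omega> ^ l) \<partial>M)"
proof (induction w arbitrary: j l)
  case Nil
  show ?case
    using centered_sum_integrable centered_sum_convergent[OF assms] by simp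
next
  case (Cons b w)
  define F where "F j l n \<omega> = \<phi> (centered_sum n \<omega> ^ j *
    prod_list (map (\<lambda>b. normalized_pair n b \<omega>) w)) * complex_of_real (fluctuation n \<omega> ^ l)" for j l n \<omega>
  have int: "integrable M (F j l n)" if "n \<ge> 1" for j l n
    using Cons[of j l] that by (simp add: F_def[abs_def])
  have conv: "convergent (\<lambda>n. \<integral>\<omega>. F j l n \<omega> \<partial>M)" for j l
    using Cons[of j l] by (simp add: F_def)
  show ?case
  proof (cases b)
    case False
    then have "\<phi> (centered_sum n \<omega> ^ j * prod_list (map (\<lambda>b. normalized_pair n b \<omega>) (b # w))) *
        complex_of_real (fluctuation n \<omega> ^ l) = F j (Suc l) n \<omega>" for n \<omega>
      by (simp add: F_def normalized_pair_def scaleC_one_mult scaleC_mult_right \<phi>_scaleC mult_ac)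
    then show ?thesis using int conv by simp
  next
    case True
    then have "\<phi> (centered_sum n \<omega> ^ j * prod_list (map (\<lambda>b. normalized_pair n b \<omega>) (b # w))) *
        complex_of_real (fluctuation n \<omega> ^ l) = F (Suc j) l n \<omega> + F j (Suc l) n \<omega>" for n \<omega>
      by (simp add: F_def normalized_pair_True distrib_left distrib_right \<phi>_add scaleC_one_mult
          scaleC_mult_right \<phi>_scaleC mult_ac power_Suc2 flip: mult.assoc del: power_Suc)
    moreover have "\<forall>\<^sub>F n in sequentially. (\<integral>\<omega>. F (Suc j) l n \<omega> \<partial>M) + (\<integral>\<omega>. F j (Suc l) n \<omega> \<partial>M) =
        (\<integral>\<omega>. F (Suc j) l n \<omega> + F j (Suc l) n \<omega> \<partial>M)"
      using eventually_ge_at_top[of 1] by eventually_elim (simp add: int)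
    then have "convergent (\<lambda>n. \<integral>\<omega>. F (Suc j) l n \<omega> + F j (Suc l) n \<omega> \<partial>M)"
      by (rule convergent_eventually_eq[OF convergent_add[OF conv conv]])
    ultimately show ?thesis using int by simp
  qed
qed

theorem joint_star_convergent_normalized_pair:
  assumes moments: "moments_convergent M fluctuation"
    and degenerate: "convergent (\<lambda>n. \<eta> n / \<sigma> n ^ 2) \<or>
      (\<forall>n \<omega>. \<forall>j\<ge>1. \<phi> (centered_sum n \<omega> ^ j) = 0)"
  shows "joint_star_convergent scaleC \<phi> M normalized_pair"
  unfolding joint_star_convergent_def
proof
  fix Q :: "bool list \<Rightarrow>\<^sub>0 complex"
  let ?W = "\<lambda>w n \<omega>. \<phi> (prod_list (map (\<lambda>b. normalized_pair n b \<omega>) w))"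
  let ?c = "Poly_Mapping.lookup Q" and ?K = "Poly_Mapping.keys Q"
  have int: "integrable M (?W w n)" if "n \<ge> 1" for w n
    using normalized_word_convergent[OF assms, of 0 w 0] that by simp
  have conv: "convergent (\<lambda>n. \<integral>\<omega>. ?W w n \<omega> \<partial>M)" for w
    using normalized_word_convergent[OF assms, of 0 w 0] by simp
  have eval: "\<phi> (nc_poly_eval scaleC Q (\<lambda>b. normalized_pair n b \<omega>)) = (\<Sum>w\<in>?K. ?c w * ?W w n \<omega>)" for n \<omega>
    by (simp add: nc_poly_eval_def \<phi>_sum \<phi>_scaleC)
  have lim: "convergent (\<lambda>n. \<Sum>w\<in>?K. ?c w * (\<integral>\<omega>. ?W w n \<omega> \<partial>M))"
    by (intro convergent_sum convergent_mult convergent_const conv)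
  have "\<forall>\<^sub>F n in sequentially. integrable M (\<lambda>\<omega>. \<phi> (nc_poly_eval scaleC Q (\<lambda>b. normalized_pair n b \<omega>)))"
    using eventually_ge_at_top[of 1] by eventually_elim (simp add: eval int)
  moreover have "convergent (\<lambda>n. random_state M \<phi> (\<lambda>\<omega>. nc_poly_eval scaleC Q (\<lambda>b. normalized_pair n b \<omega>)))"
  proof (rule convergent_eventually_eq[OF lim])
    show "\<forall>\<^sub>F n in sequentially. (\<Sum>w\<in>?K. ?c w * (\<integral>\<omega>. ?W w n \<omega> \<partial>M)) =
      random_state M \<phi> (\<lambda>\<omega>. nc_poly_eval scaleC Q (\<lambda>b. normalized_pair n b \<omega>))"
    using eventually_ge_at_top[of 1]
    by eventually_elim (simp add: random_state_def eval int Bochner_Integration.integral_sum)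
  qed
  ultimately show "(\<forall>\<^sub>F n in sequentially.
       integrable M (\<lambda>\<omega>. \<phi> (nc_poly_eval scaleC Q (\<lambda>b. normalized_pair n b \<omega>)))) \<and>
      convergent (\<lambda>n. random_state M \<phi> (\<lambda>\<omega>. nc_poly_eval scaleC Q (\<lambda>b. normalized_pair n b \<omega>)))"
    by blast
qed

theorem moments_convergent_of_joint:
  assumes "joint_star_convergent scaleC \<phi> M normalized_pair"
  shows "moments_convergent M fluctuation"
  unfolding moments_convergent_def
proof
  fix m
  define Q :: "bool list \<Rightarrow>\<^sub>0 complex" where "Q = Poly_Mapping.single (replicate m False) 1"
  have "\<phi> (nc_poly_eval scaleC Q (\<lambda>b. normalized_pair n b \<omega>)) = complex_of_real (fluctuation n \<omega> ^ m)" for n \<omega>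
    by (simp add: Q_def nc_poly_eval_def normalized_pair_def scaleC_power prod_list_replicate
        \<phi>_scaleC \<phi>_one)
  moreover have "convergent (\<lambda>n. random_state M \<phi> (\<lambda>\<omega>. nc_poly_eval scaleC Q (\<lambda>b. normalized_pair n b \<omega>)))"
    using assms unfolding joint_star_convergent_def by blast
  ultimately have "convergent (\<lambda>n. complex_of_real (\<integral>\<omega>. fluctuation n \<omega> ^ m \<partial>M))"
    by (simp add: random_state_def del: of_real_power)
  then obtain L where "(\<lambda>n. complex_of_real (\<integral>\<omega>. fluctuation n \<omega> ^ m \<partial>M)) \<longlonglongrightarrow> L"
    unfolding convergent_def by blast
  \<comment> \<open>The state takes complex values, so the real limit is recovered through real
    parts.\<close>
  from tendsto_Re[OF this] show "convergent (\<lambda>n. \<integral>\<omega>. fluctuation n \<omega> ^ m \<partial>M)"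
    by (simp add: convergentI)
qed

end

section \<open>The equivalences for the normalized random sums\<close>

theorem corollary4p1:
  fixes scaleC :: "complex \<Rightarrow> 'a::ring_1 \<Rightarrow> 'a" and star :: "'a \<Rightarrow> 'a" and \<phi> :: "'a \<Rightarrow> complex"
    and a :: "nat \<Rightarrow> 'a"
    and M :: "'w measure" and N :: "nat \<Rightarrow> 'w \<Rightarrow> nat"
    and \<alpha> \<theta>2 :: real and \<eta> \<gamma> \<sigma> \<delta> :: "nat \<Rightarrow> real"
    and S_tilde \<delta>N_unit :: "nat \<Rightarrow> 'w \<Rightarrow> 'a"
    and N_tilde \<delta>N :: "nat \<Rightarrow> 'w \<Rightarrow> real"
  defines "\<alpha> \<equiv> Re (\<phi> (a 1))"
    and "\<theta>2 \<equiv> Re (\<phi> (a 1 ^ 2)) - \<alpha> ^ 2"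
    and "\<eta> \<equiv> \<lambda>n. \<integral>\<omega>. real (N n \<omega>) \<partial>M"
    and "\<gamma> \<equiv> \<lambda>n. sqrt (\<integral>\<omega>. (real (N n \<omega>) - \<eta> n) ^ 2 \<partial>M)"
    and "\<sigma> \<equiv> \<lambda>n. sqrt (\<eta> n * \<theta>2 + \<gamma> n ^ 2 * \<alpha> ^ 2)"
    and "\<delta> \<equiv> \<lambda>n. \<gamma> n * \<alpha> / \<sigma> n"
    and "N_tilde \<equiv> \<lambda>n \<omega>. (real (N n \<omega>) - \<eta> n) / \<gamma> n"
    and "\<delta>N \<equiv> \<lambda>n \<omega>. \<alpha> * (real (N n \<omega>) - \<eta> n) / \<sigma> n"
    and "S_tilde \<equiv> \<lambda>n \<omega>. scaleC (complex_of_real (1 / \<sigma> n))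
           (partial_sum a (N n \<omega>) - scaleC (complex_of_real (\<eta> n * \<alpha>)) 1)"
    and "\<delta>N_unit \<equiv> \<lambda>n \<omega>. scaleC (complex_of_real (\<delta>N n \<omega>)) 1"
  assumes space: "star_prob_space scaleC star \<phi>"
    and selfadjoint: "\<And>i. i \<ge> 1 \<Longrightarrow> star (a i) = a i"
    and free: "free_variables scaleC star \<phi> {1..} a"
    and identically_distributed: "\<And>i m. i \<ge> 1 \<Longrightarrow> \<phi> (a i ^ m) = \<phi> (a 1 ^ m)"
    and mean_nonzero: "\<alpha> \<noteq> 0"
    and prob: "prob_space M"
    and random: "\<And>n. n \<ge> 1 \<Longrightarrow> N n \<in> measurable M (count_space UNIV)"
    and moments_finite: "\<And>n m. n \<ge> 1 \<Longrightarrow> integrable M (\<lambda>\<omega>. real (N n \<omega>) ^ m)"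
    and mean_at_top: "filterlim \<eta> at_top sequentially"
    and variance_at_top: "filterlim (\<lambda>n. \<sigma> n ^ 2) at_top sequentially"
    and central_moments: "\<And>m. (\<lambda>n. \<integral>\<omega>. \<bar>real (N n \<omega>) - \<eta> n\<bar> ^ m \<partial>M) \<in> O(\<lambda>n. \<sigma> n ^ m)"
  shows "(joint_star_convergent scaleC \<phi> M (\<lambda>n b. if b then S_tilde n else \<delta>N_unit n) \<longleftrightarrow>
            convergent \<delta> \<and> moments_convergent M \<delta>N) \<and>
         (\<forall>d. d \<noteq> 0 \<longrightarrow> \<delta> \<longlonglongrightarrow> d \<longrightarrow>
            (joint_star_convergent scaleC \<phi> M (\<lambda>n b. if b then S_tilde n else \<delta>N_unit n) \<longleftrightarrow>
             moments_convergent M N_tilde))"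
proof -
  interpret star_prob_space scaleC star \<phi> by (rule space)
  interpret iid: free_iid scaleC star \<phi> a
    by unfold_locales (rule free selfadjoint identically_distributed, assumption?)+
  have mean: "\<phi> (a 1) = complex_of_real \<alpha>"
    unfolding \<alpha>_def by (rule \<phi>_selfadjoint_real) (simp add: selfadjoint)
  have "star (a 1 ^ 2) = a 1 ^ 2"
    using selfadjoint[of 1] by (simp add: power2_eq_square star_mult)
  then have second: "\<phi> (a 1 ^ 2) = complex_of_real (\<theta>2 + \<alpha> ^ 2)"
    unfolding \<theta>2_def diff_add_cancel by (rule \<phi>_selfadjoint_real)

  have \<gamma>_nonneg: "\<gamma> n \<ge> 0" and \<gamma>_sq: "\<gamma> n ^ 2 = (\<integral>\<omega>. (real (N n \<omega>) - \<eta> n) ^ 2 \<partial>M)" for n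
    by (simp_all add: \<gamma>_def)
  have \<theta>2_nonneg: "\<theta>2 \<ge> 0"
  proof -
    have "\<phi> (iid.centered 1 * iid.centered 1) = complex_of_real \<theta>2"
      using iid.centered_variance[of 1] mean second by simp
    then show ?thesis
      using \<phi>_positive[of "iid.centered 1"] iid.star_centered[of 1]
      by (simp add: complex_nonneg_Reals_iff)
  qed
  \<comment> \<open>\<open>sqrt\<close> of a negative real is negative here, so a nonnegative
    radicand is what gives \<open>\<sigma> n \<ge> 0\<close> and the intended value of
    \<open>\<sigma> n ^ 2\<close>.\<close>
  have variance_nonneg: "\<forall>\<^sub>F n in sequentially. \<eta> n * \<theta>2 + \<gamma> n ^ 2 * \<alpha> ^ 2 \<ge> 0"
    using mean_at_top[unfolded filterlim_at_top, rule_format, of 0]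
    by eventually_elim (simp add: \<theta>2_nonneg)
  have "filterlim (\<lambda>n. sqrt (\<sigma> n ^ 2)) at_top sequentially"
    by (rule filterlim_compose[OF sqrt_at_top variance_at_top])
  moreover have "\<forall>\<^sub>F n in sequentially. sqrt (\<sigma> n ^ 2) = \<sigma> n"
    using variance_nonneg by eventually_elim (simp add: \<sigma>_def)
  ultimately have scale_at_top: "filterlim \<sigma> at_top sequentially"
    by (simp cong: filterlim_cong)

  interpret rs: free_random_sum scaleC star \<phi> a M N \<alpha> \<eta> \<sigma>
    by unfold_locales (use mean_nonzero moments_finite scale_at_top mean in auto)
  have fluctuation: "rs.fluctuation = \<delta>N"
    by (intro ext) (simp add: rs.fluctuation_def \<delta>N_def)
  have pair: "rs.normalized_pair = (\<lambda>n b. if b then S_tilde n else \<delta>N_unit n)"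
    by (intro ext) (simp add: rs.normalized_pair_def S_tilde_def \<delta>N_unit_def fluctuation)

  have \<delta>_sq: "(\<integral>\<omega>. \<delta>N n \<omega> ^ 2 \<partial>M) = \<delta> n ^ 2" for n
  proof -
    have "\<delta>N n \<omega> ^ 2 = (\<alpha> / \<sigma> n) ^ 2 * (real (N n \<omega>) - \<eta> n) ^ 2" for \<omega>
      by (simp add: \<delta>N_def power_mult_distrib power_divide)
    then show ?thesis
      by (simp add: \<delta>_def power_mult_distrib power_divide mult.commute flip: \<gamma>_sq)
  qed
  have \<delta>_convergent: "convergent \<delta>" if "moments_convergent M \<delta>N"
  proof (rule convergent_eventually_eq)
    have "convergent (\<lambda>n. \<delta> n ^ 2)"
      using that unfolding moments_convergent_def by (simp flip: \<delta>_sq)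
    then obtain L where "(\<lambda>n. \<delta> n ^ 2) \<longlonglongrightarrow> L"
      unfolding convergent_def by blast
    \<comment> \<open>The second moment only determines the absolute value of
      \<open>\<delta> n\<close>; its sign is eventually that of \<alpha> unless it is zero, since
      \<open>\<gamma> n \<ge> 0\<close> and \<open>\<sigma> n > 0\<close>.\<close>
    then have "(\<lambda>n. sgn \<alpha> * sqrt (\<delta> n ^ 2)) \<longlonglongrightarrow> sgn \<alpha> * sqrt L"
      by (intro tendsto_intros)
    then show "convergent (\<lambda>n. sgn \<alpha> * sqrt (\<delta> n ^ 2))"
      by (rule convergentI)
    show "\<forall>\<^sub>F n in sequentially. sgn \<alpha> * sqrt (\<delta> n ^ 2) = \<delta> n"
      using rs.scale_pos
    proof eventually_elim
      case (elim n)
      then show ?case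
        using \<gamma>_nonneg[of n] by (simp add: \<delta>_def abs_mult sgn_mult_abs mult.left_commute)
    qed
  qed
  \<comment> \<open>The ratio is read off from
    \<open>1 - \<delta> n ^ 2 = \<eta> n * \<theta>2 / \<sigma> n ^ 2\<close>. For
    \<open>\<theta>2 = 0\<close> this identity says nothing about the ratio, hence the second
    alternative.\<close>
  have degenerate: "convergent (\<lambda>n. \<eta> n / \<sigma> n ^ 2) \<or>
      (\<forall>n \<omega>. \<forall>j\<ge>1. \<phi> (rs.centered_sum n \<omega> ^ j) = 0)" if "convergent \<delta>"
  proof (cases "\<theta>2 = 0")
    case True
    then show ?thesis
      using rs.centered_sum_power_null mean second by simp
  next
    case False
    have "convergent (\<lambda>n. (1 - \<delta> n ^ 2) * (1 / \<theta>2))"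
      by (intro convergent_mult convergent_diff convergent_const convergent_power that)
    moreover have "\<forall>\<^sub>F n in sequentially. (1 - \<delta> n ^ 2) * (1 / \<theta>2) = \<eta> n / \<sigma> n ^ 2"
      using variance_nonneg rs.scale_pos
    proof eventually_elim
      case (elim n)
      then have "\<sigma> n ^ 2 = \<eta> n * \<theta>2 + \<gamma> n ^ 2 * \<alpha> ^ 2"
        by (simp add: \<sigma>_def)
      then have "\<eta> n * \<theta>2 = \<sigma> n ^ 2 - \<gamma> n ^ 2 * \<alpha> ^ 2"
        by simp
      moreover have "\<delta> n ^ 2 = \<gamma> n ^ 2 * \<alpha> ^ 2 / \<sigma> n ^ 2"
        by (simp add: \<delta>_def power_mult_distrib power_divide)
      ultimately have "1 - \<delta> n ^ 2 = \<eta> n * \<theta>2 / \<sigma> n ^ 2"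
        using elim(2) by (simp add: diff_divide_distrib)
      then show ?case using False by simp
    qed
    ultimately have "convergent (\<lambda>n. \<eta> n / \<sigma> n ^ 2)"
      by (rule convergent_eventually_eq)
    then show ?thesis ..
  qed
  have joint: "joint_star_convergent scaleC \<phi> M (\<lambda>n b. if b then S_tilde n else \<delta>N_unit n) \<longleftrightarrow>
      moments_convergent M \<delta>N"
    using rs.moments_convergent_of_joint rs.joint_star_convergent_normalized_pair degenerate \<delta>_convergent
    unfolding fluctuation pair by blast
  have rescale: "moments_convergent M \<delta>N \<longleftrightarrow> moments_convergent M N_tilde"
    if "d \<noteq> 0" "\<delta> \<longlonglongrightarrow> d" for d
  proof -
    have nz: "\<forall>\<^sub>F n in sequentially. \<delta> n \<noteq> 0"
      by (rule tendsto_imp_eventually_ne[OF that(2,1)])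
    \<comment> \<open>The condition \<open>\<delta> n \<noteq> 0\<close> excludes
      \<open>\<gamma> n = 0\<close>, where \<open>N_tilde\<close> would be a division by zero; it
      holds eventually because the limit \<open>d\<close> is nonzero.\<close>
    have moments: "(\<integral>\<omega>. \<delta>N n \<omega> ^ m \<partial>M) = \<delta> n ^ m * (\<integral>\<omega>. N_tilde n \<omega> ^ m \<partial>M)"
      if "\<delta> n \<noteq> 0" for n m
    proof -
      have "\<delta>N n \<omega> = \<delta> n * N_tilde n \<omega>" for \<omega>
        using that by (auto simp: \<delta>_def \<delta>N_def N_tilde_def)
      then show ?thesis by (simp add: power_mult_distrib)
    qed
    have conv: "convergent \<delta>" "convergent (\<lambda>n. 1 / \<delta> n)"
      using that by (auto intro!: convergentI tendsto_divide tendsto_const)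
    have "convergent (\<lambda>n. \<integral>\<omega>. \<delta>N n \<omega> ^ m \<partial>M) \<longleftrightarrow> convergent (\<lambda>n. \<integral>\<omega>. N_tilde n \<omega> ^ m \<partial>M)" for m
    proof
      assume "convergent (\<lambda>n. \<integral>\<omega>. \<delta>N n \<omega> ^ m \<partial>M)"
      then have "convergent (\<lambda>n. (1 / \<delta> n) ^ m * (\<integral>\<omega>. \<delta>N n \<omega> ^ m \<partial>M))"
        by (intro convergent_mult convergent_power conv)
      then show "convergent (\<lambda>n. \<integral>\<omega>. N_tilde n \<omega> ^ m \<partial>M)"
        by (rule convergent_eventually_eq)
           (use nz in eventually_elim, simp add: moments power_divide)
    next
      assume "convergent (\<lambda>n. \<integral>\<omega>. N_tilde n \<omega> ^ m \<partial>M)"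
      then have "convergent (\<lambda>n. \<delta> n ^ m * (\<integral>\<omega>. N_tilde n \<omega> ^ m \<partial>M))"
        by (intro convergent_mult convergent_power conv)
      then show "convergent (\<lambda>n. \<integral>\<omega>. \<delta>N n \<omega> ^ m \<partial>M)"
        by (rule convergent_eventually_eq) (use nz in eventually_elim, simp add: moments)
    qed
    then show ?thesis by (simp add: moments_convergent_def)
  qed
  show ?thesis
    using joint \<delta>_convergent rescale by blast
qed

end
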